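(* Let $\mathcal{L}_1$ and $\mathcal{L}_2$ be two non-constant $L$-functions in the extended Selberg class $\mathcal{S}^{\#}$, both of degree zero, satisfying the same functional equation, and each with first Dirichlet coefficient $a(1)=1$. Let $n\ge 1$ be an integer and let $S=\{\alpha_1,\alpha_2,\ldots,\alpha_n\}\subset\mathbb{C}$ be a set of $n$ distinct complex numbers. If $\mathcal{L}_1$ and $\mathcal{L}_2$ share the set $S$ counting multiplicities, then $\mathcal{L}_1=\mathcal{L}_2$.
   Context: The extended Selberg class $\mathcal{S}^{\#}$ consists of the not identically vanishing Dirichlet series $\mathcal{L}(s)=\sum_{n=1}^{\infty}a(n)n^{-s}$ such that: (i) the series converges absolutely for $\Re(s)>1$; (ii) (analytic continuation) there is an integer $k\ge 0$ such that $(s-1)^k\mathcal{L}(s)$ extends to an entire function of finite order; (iii) (functional equation) there are an integer $K\ge 0$, reals $Q>0$, $\lambda_j>0$, complex numbers $\nu_j$ with $\Re(\nu_j)\ge 0$ ($1\le j\le K$) and $\omega\in\mathbb{C}$ with $|\omega|=1$ such that $\Lambda(s)=\omega\,\overline{\Lambda(1-\overline{s})}$, where $\Lambda(s)=\mathcal{L}(s)Q^s\prod_{j=1}^{K}\Gamma(\lambda_j s+\nu_j)$. The degree of $\mathcal{L}$ is $d_{\mathcal{L}}=2\sum_{j=1}^{K}\lambda_j$ (so $d_{\mathcal{L}}=0$ iff $K=0$); it depends only on $\mathcal{L}$. "$L$-function" means an element of $\mathcal{S}^{\#}$, regarded as a meromorphic function on $\mathbb{C}$ (with at most a pole at $s=1$).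 Two $L$-functions satisfy the same functional equation if (iii) holds for both with the same data $K,Q,\lambda_j,\nu_j,\omega$. Two meromorphic functions $f,g$ on $\mathbb{C}$ share a finite set $S\subset\mathbb{C}$ counting multiplicities (CM) if the functions $\prod_{\alpha\in S}(f-\alpha)$ and $\prod_{\alpha\in S}(g-\alpha)$ have the same zeros with the same multiplicities. *)

theory Defs
  imports "HOL-Complex_Analysis.Complex_Analysis"
begin

text \<open>
  An L-function is represented by its meromorphic continuation to the whole plane, normalised by
  \<open>nicely_meromorphic_on\<close>: removable singularities are filled in and the value at a pole is 0.
  With this convention, equality of HOL functions is equality of meromorphic functions.
\<close>

text \<open>The coefficient \<open>a 0\<close> plays no role: the series is over \<open>n = 1, 2, \<dots>\<close>.\<close>

definition dirichlet_series_of :: "(nat \<Rightarrow> complex) \<Rightarrow> (complex \<Rightarrow> complex) \<Rightarrow> bool" where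
  "dirichlet_series_of a L \<longleftrightarrow> (\<forall>s. Re s > 1 \<longrightarrow>
     summable (\<lambda>n. norm (a (Suc n) * of_nat (Suc n) powr (- s))) \<and>
     (\<lambda>n. a (Suc n) * of_nat (Suc n) powr (- s)) sums L s)"

definition entire_of_finite_order :: "(complex \<Rightarrow> complex) \<Rightarrow> bool" where
  "entire_of_finite_order F \<longleftrightarrow> F holomorphic_on UNIV \<and>
     (\<exists>\<rho>::real. \<forall>\<^sub>F z in at_infinity. norm (F z) \<le> exp (norm z powr \<rho>))"

definition completed_L ::
    "nat \<Rightarrow> real \<Rightarrow> (nat \<Rightarrow> real) \<Rightarrow> (nat \<Rightarrow> complex) \<Rightarrow> (complex \<Rightarrow> complex) \<Rightarrow> complex \<Rightarrow> complex" where
  "completed_L K Q lam nu L s =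
     L s * of_real Q powr s * (\<Prod>j\<in>{1..K}. Gamma (of_real (lam j) * s + nu j))"

text \<open>
  The functional equation is an identity of meromorphic functions. HOL assigns the value 0 to
  \<open>Gamma\<close> and to \<open>L\<close> at their poles, so the pointwise identity is required only off a set without
  accumulation points (\<open>\<forall>\<^sub>\<approx>\<close>).
\<close>

definition functional_equation ::
    "nat \<Rightarrow> real \<Rightarrow> (nat \<Rightarrow> real) \<Rightarrow> (nat \<Rightarrow> complex) \<Rightarrow> complex \<Rightarrow> (complex \<Rightarrow> complex) \<Rightarrow> bool" where
  "functional_equation K Q lam nu \<omega> L \<longleftrightarrow>
     Q > 0 \<and> (\<forall>j\<in>{1..K}. lam j > 0 \<and> Re (nu j) \<ge> 0) \<and> norm \<omega> = 1 \<and>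
     (\<forall>\<^sub>\<approx>s. completed_L K Q lam nu L s = \<omega> * cnj (completed_L K Q lam nu L (1 - cnj s)))"

definition extended_selberg :: "(complex \<Rightarrow> complex) set" where
  "extended_selberg = {L. L nicely_meromorphic_on UNIV \<and> (\<exists>s. L s \<noteq> 0) \<and>
     (\<exists>a. dirichlet_series_of a L) \<and>
     (\<exists>(k::nat) F. entire_of_finite_order F \<and> (\<forall>s. s \<noteq> 1 \<longrightarrow> F s = (s - 1) ^ k * L s)) \<and>
     (\<exists>K Q lam nu \<omega>. functional_equation K Q lam nu \<omega> L)}"

text \<open>The degree does not depend on the chosen data of the functional equation, so the choice
  operator picks the only possible value.\<close>

definition selberg_degree :: "(complex \<Rightarrow> complex) \<Rightarrow> real" where
  "selberg_degree L = (SOME d. \<exists>K Q lam nu \<omega>.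
     functional_equation K Q lam nu \<omega> L \<and> d = 2 * (\<Sum>j\<in>{1..K}. lam j))"

definition same_functional_equation :: "(complex \<Rightarrow> complex) \<Rightarrow> (complex \<Rightarrow> complex) \<Rightarrow> bool" where
  "same_functional_equation L1 L2 \<longleftrightarrow> (\<exists>K Q lam nu \<omega>.
     functional_equation K Q lam nu \<omega> L1 \<and> functional_equation K Q lam nu \<omega> L2)"

text \<open>
  For meromorphic functions. A zero is expressed by the limit 0 rather than by the value 0,
  since the value at a pole is conventional: if \<open>0 \<in> S\<close> and \<open>f z = 0\<close> by convention at a
  pole \<open>z\<close>, then \<open>\<Prod>\<alpha>\<in>S. f z - \<alpha>\<close> vanishes at \<open>z\<close> although \<open>z\<close> is not a zero.
\<close>

definition same_zeros_CM :: "(complex \<Rightarrow> complex) \<Rightarrow> (complex \<Rightarrow> complex) \<Rightarrow> bool" where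
  "same_zeros_CM F G \<longleftrightarrow>
     (\<forall>z. (F \<midarrow>z\<rightarrow> 0 \<longleftrightarrow> G \<midarrow>z\<rightarrow> 0) \<and> (F \<midarrow>z\<rightarrow> 0 \<longrightarrow> zorder F z = zorder G z))"

definition share_set_CM :: "(complex \<Rightarrow> complex) \<Rightarrow> (complex \<Rightarrow> complex) \<Rightarrow> complex set \<Rightarrow> bool" where
  "share_set_CM f g S \<longleftrightarrow>
     same_zeros_CM (\<lambda>z. \<Prod>\<alpha>\<in>S. f z - \<alpha>) (\<lambda>z. \<Prod>\<alpha>\<in>S. g z - \<alpha>)"

end

theory Submission
  imports Defs "HOL-Real_Asymp.Real_Asymp"
begin

text \<open>
  In degree zero the functional equation reads \<open>L s = X s * cnj (L (1 - cnj s))\<close> with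
  \<open>X s = \<omega> * Q powr (1 - 2 * s)\<close>, so \<open>L\<close> is entire and, by Phragmen-Lindelof, bounded in vertical
  strips; if \<open>Q \<le> 1\<close> it would be bounded, hence \<open>Q > 1\<close>. As \<open>Re s\<close> tends to \<open>-\<infinity>\<close>, both
  \<open>L1 s\<close> and \<open>L2 s\<close> are asymptotic to \<open>X s\<close>, which tends to infinity. With \<open>P\<close> the monic
  polynomial with zero set \<open>S\<close>, the entire function \<open>E = P(L1) / P(L2)\<close> has no zeros and tends to 1
  on the left. It is bounded in strips by a normal family argument on vertical translates, and
  comparing leading Dirichlet terms on the right, either \<open>E\<close> or \<open>1 / E\<close> is bounded there, so \<open>E = 1\<close>
  by Liouville. Finally \<open>P(x) - P(y) = (x - y) * R(x, y)\<close>, where \<open>R(L1, L2)\<close> is asymptotic to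
  \<open>n * X ^ (n - 1)\<close> on the left, and so \<open>L1 = L2\<close>.
\<close>

section \<open>Phragmen-Lindelof bound in a vertical strip\<close>

text \<open>The damping factor \<open>exp (- \<epsilon> cos (\<delta> (z - c)))\<close> decays doubly exponentially in the strip.\<close>

lemma phragmen_lindelof_strip:
  fixes f :: "complex \<Rightarrow> complex" and a b M \<rho> :: real
  assumes hol: "f holomorphic_on UNIV" and ab: "a < b" and M: "M > 0"
    and bd: "\<And>z. Re z = a \<or> Re z = b \<Longrightarrow> norm (f z) \<le> M"
    and growth: "\<forall>\<^sub>F z in at_infinity. norm (f z) \<le> exp (norm z powr \<rho>)"
    and z: "a \<le> Re z" "Re z \<le> b"
  shows "norm (f z) \<le> M"
proof -
  define c where "c = (a + b) / 2"
  \<comment> \<open>This scaling keeps \<open>d * (Re s - c)\<close> within [-1/2, 1/2], well inside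
    (-pi/2, pi/2), so its cosine is at least \<open>k = cos (1/2) > 0\<close> throughout the
    strip.\<close>
  define d where "d = 1 / (b - a)"
  define w where "w = (\<lambda>z::complex. cos (of_real d * (z - of_real c)))"
  define B where "B = \<bar>a\<bar> + \<bar>b\<bar>"
  \<comment> \<open>The given exponent may be negative; raising it to at least 1 makes
    \<open>t powr r\<close> increasing, so that on the horizontal sides the growth can be bounded by
    its value at \<open>T + B\<close>.\<close>
  define r where "r = max \<rho> 1"
  define k where "k = cos (1/2 :: real)"
  have d: "d > 0" using ab by (simp add: d_def)
  have k: "k > 0" unfolding k_def using pi_gt3 by (intro cos_gt_zero) auto
  have re_w: "Re (w s) \<ge> k * exp (d * \<bar>Im s\<bar>) / 2" if s: "a \<le> Re s" "Re s \<le> b" for s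
  proof -
    have "\<bar>Re s - c\<bar> \<le> (b - a) / 2"
      using s unfolding c_def by (auto simp: abs_if field_simps)
    hence "d * \<bar>Re s - c\<bar> \<le> 1/2"
      using ab by (simp add: d_def field_simps)
    hence "\<bar>d * (Re s - c)\<bar> \<le> 1/2"
      using d by (simp add: abs_mult)
    hence 1: "cos \<bar>d * (Re s - c)\<bar> \<ge> k"
      unfolding k_def using pi_gt3 by (subst cos_mono_le_eq) auto
    have 2: "exp (d * Im s) + exp (- (d * Im s)) \<ge> exp (d * \<bar>Im s\<bar>)"
      by (auto simp: abs_if)
    have "k * exp (d * \<bar>Im s\<bar>) \<le> cos (d * (Re s - c)) * (exp (d * Im s) + exp (- (d * Im s)))"
      using 1 2 k by (intro mult_mono) auto
    thus ?thesis
      by (simp add: w_def Re_cos)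
  qed
  have main: "norm (f z) * exp (- (e * Re (w z))) \<le> M" if e: "e > 0" for e
  proof -
    define g where "g = (\<lambda>s. f s * exp (- (of_real e * w s)))"
    have norm_g: "norm (g s) = norm (f s) * exp (- (e * Re (w s)))" for s
      by (simp add: g_def norm_mult)
    have "filterlim (\<lambda>t::real. (t + B) powr r - e * (k * exp (d * t) / 2)) at_bot at_top"
      using d k e by (simp add: r_def) real_asymp
    hence ev1: "\<forall>\<^sub>F t in at_top. (t + B) powr r - e * (k * exp (d * t) / 2) \<le> ln M"
      by (simp add: filterlim_at_bot)
    obtain N where N: "\<And>z. norm z \<ge> N \<Longrightarrow> norm (f z) \<le> exp (norm z powr \<rho>)"
      using growth by (auto simp: eventually_at_infinity)
    \<comment> \<open>The rectangle of half-height \<open>T\<close> contains \<open>z\<close>, and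
      on its horizontal sides the damping of size \<open>exp (d * T)\<close> already outweighs the
      growth \<open>(T + B) powr r\<close>; \<open>B\<close> absorbs the real part in the
      norm.\<close>
    obtain T where T: "T \<ge> N" "T \<ge> 1" "T \<ge> \<bar>Im z\<bar>"
      "(T + B) powr r - e * (k * exp (d * T) / 2) \<le> ln M"
    proof -
      have "\<forall>\<^sub>F t in at_top. t \<ge> N \<and> t \<ge> 1 \<and> t \<ge> \<bar>Im z\<bar> \<and>
          (t + B) powr r - e * (k * exp (d * t) / 2) \<le> ln M"
        using ev1 by (intro eventually_conj eventually_ge_at_top) auto
      thus ?thesis using that by (metis (mono_tags, lifting) eventually_happens trivial_limit_at_top_linorder)
    qed
    have horizontal: "norm (g s) \<le> M" if s: "a \<le> Re s" "Re s \<le> b" "\<bar>Im s\<bar> = T" for s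
    proof -
      have n: "norm s \<ge> T" "norm s \<le> T + B"
        using abs_Im_le_cmod[of s] cmod_le[of s] s by (auto simp: B_def)
      have "norm (f s) \<le> exp (norm s powr \<rho>)" using N n T by auto
      also have "norm s powr \<rho> \<le> norm s powr r"
        using n T by (intro powr_mono) (auto simp: r_def)
      also have "norm s powr r \<le> (T + B) powr r"
        using n by (intro powr_mono2) (auto simp: r_def)
      finally have 1: "norm (f s) \<le> exp ((T + B) powr r)" by simp
      have "norm (g s) \<le> exp ((T + B) powr r) * exp (- (e * (k * exp (d * T) / 2)))"
        unfolding norm_g using 1 re_w[OF s(1,2)] s(3) e by (intro mult_mono) auto
      also have "\<dots> = exp ((T + B) powr r - e * (k * exp (d * T) / 2))"
        by (simp flip: exp_add)
      also have "\<dots> \<le> exp (ln M)" using T(4) by (subst exp_le_cancel_iff)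
      finally show ?thesis using M by simp
    qed
    have vertical: "norm (g s) \<le> M" if s: "Re s = a \<or> Re s = b" for s
    proof -
      have "Re (w s) \<ge> k * exp (d * \<bar>Im s\<bar>) / 2" using s ab by (intro re_w) auto
      moreover have "k * exp (d * \<bar>Im s\<bar>) / 2 \<ge> 0" using k by simp
      ultimately have "Re (w s) \<ge> 0" by linarith
      hence "norm (g s) \<le> M * 1"
        unfolding norm_g using bd[OF s] e M by (intro mult_mono) auto
      thus ?thesis by simp
    qed
    have hg: "g holomorphic_on X" for X
      unfolding g_def w_def using holomorphic_on_subset[OF hol subset_UNIV]
      by (intro holomorphic_intros) auto
    have "norm (g z) \<le> M"
    proof (rule maximum_modulus_frontier[of g "cbox (Complex a (-T)) (Complex b T)"])
      show "norm (g s) \<le> M" if "s \<in> frontier (cbox (Complex a (-T)) (Complex b T))" for s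
      proof -
        have "s \<in> cbox (Complex a (-T)) (Complex b T)" "s \<notin> box (Complex a (-T)) (Complex b T)"
          using that by (auto simp: frontier_cbox)
        hence "a \<le> Re s" "Re s \<le> b" "\<bar>Im s\<bar> = T \<or> Re s = a \<or> Re s = b"
          using T by (auto simp: in_cbox_complex_iff in_box_complex_iff)
        thus ?thesis using horizontal vertical by blast
      qed
      show "z \<in> cbox (Complex a (- T)) (Complex b T)"
        using z T by (auto simp: in_cbox_complex_iff)
      show "bounded (cbox (Complex a (- T)) (Complex b T))" by (rule bounded_cbox)
    qed (use hg in \<open>auto intro: holomorphic_on_imp_continuous_on\<close>)
    thus ?thesis by (simp add: norm_g)
  qed
  \<comment> \<open>With \<open>z\<close> fixed, letting the damping strength \<open>e\<close> tend
    to 0 removes the damping factor.\<close>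
  have "((\<lambda>e. norm (f z) * exp (- (e * Re (w z)))) \<longlongrightarrow> norm (f z) * exp (- (0 * Re (w z)))) (at_right 0)"
    by (intro tendsto_intros)
  moreover have "\<forall>\<^sub>F e in at_right (0::real). norm (f z) * exp (- (e * Re (w z))) \<le> M"
    using main by (auto simp: eventually_at_right_less intro: eventually_mono[OF eventually_at_right_less])
  ultimately have "norm (f z) * exp (- (0 * Re (w z))) \<le> M"
    by (intro tendsto_upperbound) auto
  thus ?thesis by simp
qed

section \<open>Entire quotients and their boundedness in strips\<close>

text \<open>Equal zero orders give \<open>F / G\<close> order 0 at every point, so it has no poles
  and removing its singularities leaves an entire function. At a zero of \<open>G\<close> the
  product identity holds because \<open>F\<close> vanishes there too.\<close>

lemma entire_quotient_of_same_zeros: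
  assumes F: "F holomorphic_on UNIV" and G: "G holomorphic_on UNIV"
    and nz: "\<exists>z. F z \<noteq> 0" "\<exists>z. G z \<noteq> 0" and same: "same_zeros_CM F G"
  obtains E where "E holomorphic_on UNIV" "\<And>z. F z = E z * G z"
proof
  define h where "h = (\<lambda>z. F z / G z)"
  have an: "F analytic_on X" "G analytic_on X" for X
    using F G analytic_on_open[OF open_UNIV] analytic_on_subset[OF _ subset_UNIV] by blast+
  have mero: "F meromorphic_on X" "G meromorphic_on X" for X
    using an by (auto intro: analytic_on_imp_meromorphic_on)
  hence mh: "h meromorphic_on X" for X
    unfolding h_def by (intro meromorphic_intros)
  \<comment> \<open>\<open>same_zeros_CM\<close> speaks of limits; continuity turns these into
    values for entire functions.\<close>
  have zero_iff: "f \<midarrow>z\<rightarrow> 0 \<longleftrightarrow> f z = 0" if "f holomorphic_on UNIV" for f :: "complex \<Rightarrow> complex" and z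
  proof -
    have "isCont f z"
      using that by (meson UNIV_I continuous_on_eq_continuous_at holomorphic_on_imp_continuous_on open_UNIV)
    hence "f \<midarrow>z\<rightarrow> f z" by (simp add: isCont_def)
    thus ?thesis using LIM_unique by (metis)
  qed
  have ev_nz: "\<forall>\<^sub>F w in at z. f w \<noteq> 0"
    if f: "f holomorphic_on UNIV" "\<exists>z. f z \<noteq> 0" for f :: "complex \<Rightarrow> complex" and z
  proof -
    obtain b where "f b \<noteq> 0" using f(2) by blast
    from non_zero_neighbour_alt[of f UNIV z b, OF f(1) open_UNIV connected_UNIV UNIV_I UNIV_I this]
    show ?thesis by simp
  qed
  have not_pole: "\<not> is_pole h z" for z
  proof
    assume "is_pole h z"
    moreover have "isolated_singularity_at h z" using mh meromorphic_on_isolated_singularity by blast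
    ultimately have "zorder h z < 0" by (intro isolated_pole_imp_neg_zorder)
    moreover have "zorder h z = zorder F z - zorder G z"
      unfolding h_def by (intro Meromorphic.zorder_divide mero eventually_frequently ev_nz F G nz) auto
    moreover have "zorder F z = zorder G z"
    proof (cases "F z = 0")
      case True
      thus ?thesis using same zero_iff[OF F] by (auto simp: same_zeros_CM_def)
    next
      case False
      hence "G z \<noteq> 0" using same zero_iff[OF F] zero_iff[OF G] by (auto simp: same_zeros_CM_def)
      thus ?thesis
        using False zorder_exist_zero[of F UNIV z] zorder_exist_zero[of G UNIV z] F G nz
        by (simp add: connected_UNIV)
    qed
    ultimately show False by simp
  qed
  have "remove_sings h nicely_meromorphic_on UNIV"
    using mh by (rule remove_sings_nicely_meromorphic)
  moreover have "\<not> is_pole (remove_sings h) z" for z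
    using not_pole mh meromorphic_on_isolated_singularity by (subst is_pole_remove_sings_iff) auto
  ultimately show "remove_sings h holomorphic_on UNIV"
    by (meson nicely_meromorphic_without_singularities analytic_imp_holomorphic)
  show "F z = remove_sings h z * G z" for z
  proof (cases "G z = 0")
    case True
    thus ?thesis using same zero_iff[OF F] zero_iff[OF G] by (auto simp: same_zeros_CM_def)
  next
    case False
    hence "h analytic_on {z}" unfolding h_def using an by (intro analytic_intros) auto
    thus ?thesis using False by (simp add: h_def)
  qed
qed

lemma holomorphic_shift:
  assumes "f holomorphic_on UNIV"
  shows "(\<lambda>z. f (z + c)) holomorphic_on X"
proof -
  have "(\<lambda>z. z + c) holomorphic_on X" by (intro holomorphic_intros)
  from holomorphic_on_compose_gen[OF this assms] show ?thesis by (simp add: o_def)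
qed

text \<open>Division by \<open>G\<close> gives no bound near its zeros, so \<open>E\<close> is
  controlled from circles that avoid them. Vertical translates of \<open>G\<close> form a normal
  family, and the lower bound on the line \<open>Re z = x0\<close> keeps a limit function from
  vanishing identically. Hence, along a subsequence, \<open>G\<close> is bounded below on translates
  of one circle, and the maximum principle carries the bound for \<open>F / G\<close>
  inside.\<close>

lemma bounded_quotient_on_strip:
  fixes E F G :: "complex \<Rightarrow> complex" and b c x0 :: real
  assumes hol: "E holomorphic_on UNIV" "G holomorphic_on UNIV"
    and FEG: "\<And>z. F z = E z * G z"
    and bF: "\<And>b. \<exists>M. \<forall>z. \<bar>Re z\<bar> \<le> b \<longrightarrow> norm (F z) \<le> M"
    and bG: "\<And>b. \<exists>M. \<forall>z. \<bar>Re z\<bar> \<le> b \<longrightarrow> norm (G z) \<le> M"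
    and c: "c > 0" "\<And>z. Re z = x0 \<Longrightarrow> norm (G z) \<ge> c"
  shows "\<exists>M. \<forall>z. \<bar>Re z\<bar> \<le> b \<longrightarrow> norm (E z) \<le> M"
proof (rule ccontr)
  assume unbounded: "\<not> ?thesis"
  have "\<exists>z. \<bar>Re z\<bar> \<le> b \<and> norm (E z) > real n" for n
  proof (rule ccontr)
    assume "\<not> ?thesis"
    hence "\<forall>z. \<bar>Re z\<bar> \<le> b \<longrightarrow> norm (E z) \<le> real n" by (simp add: not_less)
    thus False using unbounded by blast
  qed
  note ex = someI_ex[OF this]
  define s where "s = (\<lambda>n. SOME z. \<bar>Re z\<bar> \<le> b \<and> norm (E z) > real n)"
  have s: "\<bar>Re (s n)\<bar> \<le> b" "norm (E (s n)) > real n" for n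
    using ex[of n] unfolding s_def by auto
  define H where "H = range (\<lambda>t::real. \<lambda>z. G (z + \<i> * of_real t))"
  \<comment> \<open>Translating by \<open>Im (s n)\<close> brings \<open>s n\<close> to the real
    point \<open>Re (s n)\<close>, which lies in a fixed disc.\<close>
  define A where "A = (\<lambda>n z. G (z + \<i> * of_real (Im (s n))))"
  have hol_H: "h holomorphic_on UNIV" if "h \<in> H" for h
  proof -
    obtain t :: real where t: "h = (\<lambda>z. G (z + \<i> * of_real t))" using \<open>h \<in> H\<close> unfolding H_def by blast
    show ?thesis unfolding t by (rule holomorphic_shift[OF hol(2)])
  qed
  have bounded_H: "\<exists>B. \<forall>h\<in>H. \<forall>z\<in>K. norm (h z) \<le> B" if K: "compact K" for K
  proof -
    obtain R where R: "\<And>z. z \<in> K \<Longrightarrow> norm z \<le> R"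
      using compact_imp_bounded[OF K] by (auto simp: bounded_iff)
    obtain M where M: "\<And>z. \<bar>Re z\<bar> \<le> R \<Longrightarrow> norm (G z) \<le> M" using bG by blast
    have "norm (h z) \<le> M" if "h \<in> H" "z \<in> K" for h z
    proof -
      obtain t :: real where t: "h = (\<lambda>z. G (z + \<i> * of_real t))" using \<open>h \<in> H\<close> unfolding H_def by blast
      have "\<bar>Re (z + \<i> * of_real t)\<bar> \<le> R"
        using R[OF \<open>z \<in> K\<close>] abs_Re_le_cmod[of z] by simp
      thus ?thesis unfolding t by (rule M)
    qed
    thus ?thesis by blast
  qed
  have "range A \<subseteq> H" by (auto simp: A_def H_def)
  from Montel[OF open_UNIV hol_H bounded_H this]
  obtain g r where g: "g holomorphic_on UNIV" and r: "strict_mono (r :: nat \<Rightarrow> nat)"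
    and lim: "\<And>x. (\<lambda>n. A (r n) x) \<longlonglongrightarrow> g x"
    and unif: "\<And>K. compact K \<Longrightarrow> uniform_limit K (A \<circ> r) g sequentially"
    by (metis UNIV_I subset_UNIV)
  \<comment> \<open>Vertical translation preserves the line \<open>Re z = x0\<close>, so the lower
    bound passes to the limit.\<close>
  have "norm (g x0) \<ge> c"
    by (rule tendsto_lowerbound[OF tendsto_norm[OF lim]]) (auto simp: A_def c(2))
  hence gx0: "g x0 \<noteq> 0" using c by auto
  have "finite {z \<in> cball 0 (b + 1). g z = 0}"
  proof (cases "g constant_on UNIV")
    case True
    hence "{z \<in> cball 0 (b + 1). g z = 0} = {}" using gx0 by (auto simp: constant_on_def)
    thus ?thesis by (metis finite.emptyI)
  next
    case False
    show ?thesis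
      by (rule holomorphic_compact_finite_zeros[OF g open_UNIV connected_UNIV _ subset_UNIV False]) simp
  qed
  moreover have "infinite {b<..<b + 1}" by (simp add: infinite_Ioo)
  \<comment> \<open>\<open>R\<close> exceeds \<open>b\<close>, so the disc contains every
    \<open>Re (s n)\<close>; it also avoids the finitely many moduli of zeros of \<open>g\<close>,
    so \<open>g\<close> has no zero on the circle.\<close>
  ultimately obtain R where R: "R \<in> {b<..<b + 1}" "R \<notin> norm ` {z \<in> cball 0 (b + 1). g z = 0}"
    by (meson finite_imageI rev_finite_subset subsetI)
  have b0: "b \<ge> 0" using s(1)[of 0] by linarith
  have g_nz: "g z \<noteq> 0" if "z \<in> sphere 0 R" for z
    using that R by force
  have "continuous_on (sphere 0 R) (\<lambda>z. norm (g z))"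
    using g by (intro continuous_intros) (meson continuous_on_subset holomorphic_on_imp_continuous_on subset_UNIV)
  moreover have "sphere 0 R \<noteq> ({} :: complex set)" using R b0 by auto
  ultimately obtain z0 where z0: "z0 \<in> sphere 0 R" "\<And>z. z \<in> sphere 0 R \<Longrightarrow> norm (g z0) \<le> norm (g z)"
    using continuous_attains_inf[of "sphere 0 R" "\<lambda>z. norm (g z)"] by auto
  define \<delta> where "\<delta> = norm (g z0)"
  have \<delta>: "\<delta> > 0" using g_nz[OF z0(1)] by (simp add: \<delta>_def)
  obtain M where M: "\<And>z. \<bar>Re z\<bar> \<le> R \<Longrightarrow> norm (F z) \<le> M" using bF by blast
  have "\<forall>\<^sub>F n in sequentially. \<forall>z\<in>sphere 0 R. dist ((A \<circ> r) n z) (g z) < \<delta> / 2"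
    using uniform_limitD[OF unif[OF compact_sphere], of "\<delta> / 2"] \<delta> by simp
  hence "\<forall>\<^sub>F n in sequentially. norm (E (s (r n))) \<le> M / (\<delta> / 2)"
  proof eventually_elim
    case (elim n)
    define t where "t = Im (s (r n))"
    have "norm (E (of_real (Re (s (r n))) + \<i> * of_real t)) \<le> M / (\<delta> / 2)"
    proof (rule maximum_modulus_frontier[of "\<lambda>z. E (z + \<i> * of_real t)" "cball 0 R"])
      have h: "(\<lambda>z. E (z + \<i> * of_real t)) holomorphic_on X" for X
        by (rule holomorphic_shift[OF hol(1)])
      show "(\<lambda>z. E (z + \<i> * of_real t)) holomorphic_on interior (cball 0 R)" by (rule h)
      show "continuous_on (closure (cball 0 R)) (\<lambda>z. E (z + \<i> * of_real t))"
        by (rule holomorphic_on_imp_continuous_on[OF h])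
      show "complex_of_real (Re (s (r n))) \<in> cball 0 R"
        using s(1)[of "r n"] R by auto
      fix z :: complex assume "z \<in> frontier (cball 0 R)"
      hence z: "z \<in> sphere 0 R" using R b0 by auto
      have "\<delta> \<le> norm (g z)" using z0(2)[OF z] by (simp add: \<delta>_def)
      also have "\<dots> \<le> norm (A (r n) z) + dist (A (r n) z) (g z)"
        by (metis add.commute dist_commute dist_norm norm_triangle_sub)
      also have "dist (A (r n) z) (g z) < \<delta> / 2" using elim z by simp
      finally have "norm (G (z + \<i> * of_real t)) \<ge> \<delta> / 2" by (simp add: A_def t_def)
      hence "norm (E (z + \<i> * of_real t)) * (\<delta> / 2) \<le> norm (F (z + \<i> * of_real t))"
        unfolding FEG norm_mult by (intro mult_left_mono) auto
      also have "\<dots> \<le> M" using abs_Re_le_cmod[of z] z by (intro M) auto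
      finally show "norm (E (z + \<i> * of_real t)) \<le> M / (\<delta> / 2)"
        using \<delta> by (simp add: field_simps)
    qed auto
    also have "of_real (Re (s (r n))) + \<i> * of_real t = s (r n)"
      by (simp add: t_def complex_eq_iff)
    finally show ?case .
  qed
  moreover have "\<forall>\<^sub>F n in sequentially. real n > M / (\<delta> / 2)"
    using filterlim_real_sequentially unfolding filterlim_at_top_dense by blast
  ultimately have "\<forall>\<^sub>F n::nat in sequentially. False"
  proof eventually_elim
    case (elim n)
    have "real n \<le> real (r n)" using seq_suble[OF r] by auto
    thus ?case using s(2)[of "r n"] elim by linarith
  qed
  thus False by simp
qed

section \<open>Dirichlet series far to the right\<close>

text \<open>For \<open>Re s \<ge> 2\<close>, each tail term is its value at 2 times
  \<open>real (Suc n) powr (2 - Re s)\<close>, and this factor is largest at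
  \<open>Suc n = m + 1\<close>. What remains is the absolutely convergent series at 2, whose sum
  enters \<open>C\<close>.\<close>

lemma dirichlet_series_leading_term:
  assumes D: "dirichlet_series_of a f" and m: "m \<ge> 1"
    and zero: "\<And>j. 1 \<le> j \<Longrightarrow> j < m \<Longrightarrow> a j = 0"
  obtains C where "C \<ge> 0" 
    "\<And>s. Re s \<ge> 2 \<Longrightarrow> norm (f s - a m * of_nat m powr (-s)) \<le> C * real (m + 1) powr (- Re s)"
proof
  define u where "u = (\<lambda>n. norm (a (Suc n)) * real (Suc n) powr (-2))"
  define C where "C = real (m + 1) powr 2 * suminf u"
  have norm_term: "norm (a (Suc n) * of_nat (Suc n) powr (-s)) = norm (a (Suc n)) * real (Suc n) powr (- Re s)" for n s
    using norm_powr_real_powr[of "of_nat (Suc n)" "-s"] by (simp add: norm_mult del: of_nat_Suc)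
  have su: "summable u"
    using D[unfolded dirichlet_series_of_def, rule_format, of 2] unfolding norm_term u_def by simp
  show "C \<ge> 0" unfolding C_def using su by (intro mult_nonneg_nonneg suminf_nonneg) (auto simp: u_def)
  show "norm (f s - a m * of_nat m powr (-s)) \<le> C * real (m + 1) powr (- Re s)" if s: "Re s \<ge> 2" for s
  proof -
    define t where "t = (\<lambda>n. a (Suc n) * of_nat (Suc n) powr (-s))"
    define v where "v = (\<lambda>n. t n - (if n = m - 1 then t n else 0))"
    have "t sums f s" using D s unfolding dirichlet_series_of_def t_def by auto
    hence sums: "v sums (f s - t (m - 1))"
      unfolding v_def by (intro sums_diff sums_single)
    have bound: "norm (v n) \<le> real (m + 1) powr (2 - Re s) * u n" for n
    proof (cases "n < m")
      case True
      hence "v n = 0" using zero[of "Suc n"] by (cases "n = m - 1") (auto simp: v_def t_def)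
      thus ?thesis by (simp add: u_def)
    next
      case False
      have "norm (v n) = norm (a (Suc n)) * real (Suc n) powr (- Re s)"
        using False m unfolding v_def t_def norm_term[symmetric] by (simp del: of_nat_Suc)
      also have "\<dots> = real (Suc n) powr (2 - Re s) * u n"
        unfolding u_def by (simp add: powr_add[symmetric] del: of_nat_Suc)
      also have "\<dots> \<le> real (m + 1) powr (2 - Re s) * u n"
        using False s by (intro mult_right_mono powr_mono2') (auto simp: u_def)
      finally show ?thesis .
    qed
    have "norm (f s - t (m - 1)) \<le> (\<Sum>n. real (m + 1) powr (2 - Re s) * u n)"
      using norm_suminf_le[OF bound summable_mult[OF su]] sums by (simp add: sums_iff)
    also have "\<dots> = C * real (m + 1) powr (- Re s)"
      using su powr_add[of "real (m + 1)" 2 "- Re s"] by (simp add: suminf_mult C_def)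
    also have "t (m - 1) = a m * of_nat m powr (-s)" using m by (simp add: t_def)
    finally show ?thesis .
  qed
qed

lemma dirichlet_series_tendsto_first_coeff:
  assumes "dirichlet_series_of a f"
  shows "(f \<longlongrightarrow> a 1) (filtercomap Re at_top)"
proof -
  obtain C where C: "C \<ge> 0"
    "\<And>s. Re s \<ge> 2 \<Longrightarrow> norm (f s - a 1 * of_nat 1 powr (-s)) \<le> C * real (1 + 1) powr (- Re s)"
    using dirichlet_series_leading_term[OF assms, of 1] by auto
  have "((\<lambda>x. C * 2 powr (- x)) \<longlongrightarrow> 0) (at_top :: real filter)"
    by real_asymp
  hence "((\<lambda>s. C * 2 powr (- Re s)) \<longlongrightarrow> 0) (filtercomap Re at_top)"
    by (rule filterlim_compose[OF _ filterlim_filtercomap])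
  moreover have "\<forall>\<^sub>F s in filtercomap Re at_top. norm (f s - a 1) \<le> C * 2 powr (- Re s)"
    using C(2) by (auto simp: eventually_filtercomap_at_top_linorder intro!: exI[of _ 2])
  ultimately have "((\<lambda>s. f s - a 1) \<longlongrightarrow> 0) (filtercomap Re at_top)"
    by (rule Lim_null_comparison[rotated])
  thus ?thesis by (simp add: LIM_zero_iff)
qed

text \<open>The leading term of a Dirichlet series oscillates with \<open>Im s\<close>, so only
  moduli are compared, uniformly in \<open>Im s\<close>. The two-sided form survives products, with
  the bases multiplying.\<close>

definition exact_decay :: "(complex \<Rightarrow> complex) \<Rightarrow> real \<Rightarrow> bool" where
  "exact_decay f m \<longleftrightarrow> m > 0 \<and> (\<exists>c>0. \<exists>C>0. \<forall>\<^sub>F s in filtercomap Re at_top.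
     c * m powr (- Re s) \<le> norm (f s) \<and> norm (f s) \<le> C * m powr (- Re s))"

lemma exact_decay_one: "exact_decay (\<lambda>_. 1) 1"
  unfolding exact_decay_def by (auto intro!: exI[of _ 1])

lemma exact_decay_mult:
  assumes "exact_decay f m" "exact_decay g k"
  shows "exact_decay (\<lambda>s. f s * g s) (m * k)"
proof -
  from assms obtain c C d D where pos: "m > 0" "k > 0" "c > 0" "C > 0" "d > 0" "D > 0" and
    ev: "\<forall>\<^sub>F s in filtercomap Re at_top. c * m powr (- Re s) \<le> norm (f s) \<and> norm (f s) \<le> C * m powr (- Re s)"
    "\<forall>\<^sub>F s in filtercomap Re at_top. d * k powr (- Re s) \<le> norm (g s) \<and> norm (g s) \<le> D * k powr (- Re s)"
    unfolding exact_decay_def by blast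
  have "\<forall>\<^sub>F s in filtercomap Re at_top. (c * d) * (m * k) powr (- Re s) \<le> norm (f s * g s)
      \<and> norm (f s * g s) \<le> (C * D) * (m * k) powr (- Re s)"
    using ev
  proof eventually_elim
    case (elim s)
    have "(c * m powr (- Re s)) * (d * k powr (- Re s)) \<le> norm (f s) * norm (g s)"
      using elim pos by (intro mult_mono) auto
    moreover have "norm (f s) * norm (g s) \<le> (C * m powr (- Re s)) * (D * k powr (- Re s))"
      using elim pos by (intro mult_mono) auto
    ultimately show ?case using pos by (simp add: norm_mult powr_mult mult_ac)
  qed
  thus ?thesis unfolding exact_decay_def using pos
    by (intro conjI exI[of _ "c * d"] exI[of _ "C * D"]) auto
qed

lemma exact_decay_prod:
  assumes "\<And>x. x \<in> S \<Longrightarrow> \<exists>m. exact_decay (f x) m"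
  shows "\<exists>m. exact_decay (\<lambda>s. \<Prod>x\<in>S. f x s) m"
  using assms
proof (induction S rule: infinite_finite_induct)
  case (insert x S)
  obtain m k where "exact_decay (f x) m" "exact_decay (\<lambda>s. \<Prod>x\<in>S. f x s) k"
    using insert.IH insert.prems by blast
  from exact_decay_mult[OF this] show ?case using insert(1,2) by auto
qed (use exact_decay_one in auto)

text \<open>The base is the least index \<open>m\<close> with a nonzero coefficient: relative to
  that term the remainder is of order \<open>(m / (m + 1)) powr Re s\<close>, which tends to
  0.\<close>

lemma dirichlet_series_exact_decay:
  assumes D: "dirichlet_series_of a f" and nz: "\<exists>s. Re s > 1 \<and> f s \<noteq> 0"
  shows "\<exists>m. exact_decay f m"
proof -
  have "\<exists>j\<ge>1. a j \<noteq> 0"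
  proof (rule ccontr)
    assume "\<not> ?thesis"
    hence "\<And>n. a (Suc n) = 0" by auto
    moreover obtain s where "Re s > 1" "f s \<noteq> 0" using nz by blast
    ultimately show False using D unfolding dirichlet_series_of_def by (auto simp: sums_iff)
  qed
  then obtain m where m: "m \<ge> 1" "a m \<noteq> 0" "\<And>j. 1 \<le> j \<Longrightarrow> j < m \<Longrightarrow> a j = 0"
    unfolding exists_least_iff[of "\<lambda>j. j \<ge> 1 \<and> a j \<noteq> 0"] by auto
  obtain C where C: "C \<ge> 0"
    "\<And>s. Re s \<ge> 2 \<Longrightarrow> norm (f s - a m * of_nat m powr (-s)) \<le> C * real (m + 1) powr (- Re s)"
    using dirichlet_series_leading_term[OF D m(1,3)] by blast
  \<comment> \<open>Half the leading coefficient: the main term has modulus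
    \<open>2 * \<epsilon> * m powr (- Re s)\<close> and the error is eventually at most half of
    that, which gives the constants \<open>\<epsilon>\<close> and
    \<open>3 * \<epsilon>\<close>.\<close>
  define \<epsilon> where "\<epsilon> = norm (a m) / 2"
  have \<epsilon>: "\<epsilon> > 0" using m by (simp add: \<epsilon>_def)
  have "real m > 0" using m by simp
  define d where "d = ln (real (m + 1)) - ln (real m)"
  have d: "d > 0" using \<open>real m > 0\<close> by (simp add: d_def)
  have "((\<lambda>x. C * exp (- (d * x))) \<longlongrightarrow> 0) (at_top :: real filter)"
    using d by real_asymp
  also have "(\<lambda>x. C * exp (- (d * x))) = (\<lambda>x. C * real (m + 1) powr (- x) / real m powr (- x))"
    using \<open>real m > 0\<close> unfolding powr_def d_def
    by (auto simp: fun_eq_iff algebra_simps exp_diff exp_minus field_simps)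
  finally have "((\<lambda>x. C * real (m + 1) powr (- x) / real m powr (- x)) \<longlongrightarrow> 0) (at_top :: real filter)" .
  hence "\<forall>\<^sub>F x in at_top. C * real (m + 1) powr (- x) / real m powr (- x) < \<epsilon>"
    using \<epsilon> by (rule order_tendstoD)
  hence "\<forall>\<^sub>F s in filtercomap Re at_top. C * real (m + 1) powr (- Re s) / real m powr (- Re s) < \<epsilon>"
    by (rule eventually_filtercomapI)
  moreover have "\<forall>\<^sub>F s in filtercomap Re at_top. Re s \<ge> 2"
    by (auto simp: eventually_filtercomap_at_top_linorder)
  ultimately have "\<forall>\<^sub>F s in filtercomap Re at_top.
      \<epsilon> * real m powr (- Re s) \<le> norm (f s) \<and> norm (f s) \<le> (3 * \<epsilon>) * real m powr (- Re s)"
  proof eventually_elim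
    case (elim s)
    have "norm (f s - a m * of_nat m powr (-s)) \<le> \<epsilon> * real m powr (- Re s)"
      using C(2)[of s] elim \<open>real m > 0\<close> by (simp add: field_simps)
    moreover have "norm (a m * of_nat m powr (-s)) = 2 * \<epsilon> * real m powr (- Re s)"
      using norm_powr_real_powr[of "of_nat m" "-s"] by (simp add: norm_mult \<epsilon>_def)
    ultimately show ?case
      using norm_triangle_ineq3[of "f s" "a m * of_nat m powr (-s)"] by linarith
  qed
  thus ?thesis unfolding exact_decay_def using \<epsilon> \<open>real m > 0\<close>
    by (intro exI[of _ "real m"] conjI exI[of _ \<epsilon>] exI[of _ "3 * \<epsilon>"]) auto
qed

text \<open>A constant is a Dirichlet series concentrated at index 1, since
  \<open>1 powr (-s) = 1\<close>. This opens the leading-term analysis to each factor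
  \<open>L s - \<alpha>\<close>.\<close>

lemma dirichlet_series_diff_const:
  assumes "dirichlet_series_of a f"
  shows "dirichlet_series_of (a(1 := a 1 - c)) (\<lambda>s. f s - c)"
  unfolding dirichlet_series_of_def
proof (intro allI impI conjI)
  fix s :: complex assume s: "Re s > 1"
  define t where "t = (\<lambda>n. a (Suc n) * of_nat (Suc n) powr (-s))"
  define e where "e = (\<lambda>n::nat. if n = 0 then c else 0)"
  have eq: "(a(1 := a 1 - c)) (Suc n) * of_nat (Suc n) powr (-s) = t n - e n" for n
    by (auto simp: t_def e_def)
  have t: "summable (\<lambda>n. norm (t n))" "t sums f s"
    using assms s unfolding dirichlet_series_of_def t_def by auto
  have "e sums c" unfolding e_def using sums_single[of 0 "\<lambda>_. c"] by simp
  thus "(\<lambda>n. (a(1 := a 1 - c)) (Suc n) * of_nat (Suc n) powr (-s)) sums (f s - c)"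
    unfolding eq using t by (intro sums_diff)
  have "summable (\<lambda>n. norm (t n) + norm (e n))"
    using t by (intro summable_add) (auto simp: e_def intro!: summable_finite[of "{0}"] split: if_splits)
  thus "summable (\<lambda>n. norm ((a(1 := a 1 - c)) (Suc n) * of_nat (Suc n) powr (-s)))"
    unfolding eq by (rule summable_comparison_test'[where N = 0]) (simp add: norm_triangle_ineq4)
qed

section \<open>The functional equation in degree zero\<close>

text \<open>The value picked by \<open>SOME\<close> is attained by some functional equation. As all
  \<open>lam j\<close> are positive, a vanishing sum forces \<open>K = 0\<close>, so the Gamma
  product is empty.\<close>

lemma degree_zero_functional_equation:
  assumes L: "L \<in> extended_selberg" and deg: "selberg_degree L = 0"
  obtains Q \<omega> where "Q > 0" "norm \<omega> = 1"
    "\<forall>\<^sub>\<approx>s. L s * of_real Q powr s = \<omega> * cnj (L (1 - cnj s) * of_real Q powr (1 - cnj s))"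
proof -
  have "\<exists>d K Q lam nu \<omega>. functional_equation K Q lam nu \<omega> L \<and> d = 2 * (\<Sum>j\<in>{1..K}. lam j)"
    using L unfolding extended_selberg_def by blast
  from someI_ex[OF this] obtain K Q lam nu \<omega> where fe: "functional_equation K Q lam nu \<omega> L"
    and sum: "0 = 2 * (\<Sum>j\<in>{1..K}. lam j)"
    using deg unfolding selberg_degree_def by auto
  have "K = 0"
  proof (rule ccontr)
    assume "K \<noteq> 0"
    hence "(\<Sum>j\<in>{1..K}. lam j) > 0"
      using fe unfolding functional_equation_def by (intro sum_pos) auto
    thus False using sum by simp
  qed
  thus ?thesis using fe that unfolding functional_equation_def completed_L_def by auto
qed

text \<open>The only possible pole is at 1, and reflection sends 1 to 0, where \<open>L\<close> is
  regular; the functional equation therefore gives \<open>L\<close> a finite limit at 1. Once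
  \<open>L\<close> is continuous everywhere, the identity extends across the exceptional sparse
  set.\<close>

lemma degree_zero_entire:
  assumes L: "L \<in> extended_selberg" and Q: "Q > 0"
    and fe: "\<forall>\<^sub>\<approx>s. L s * of_real Q powr s = \<omega> * cnj (L (1 - cnj s) * of_real Q powr (1 - cnj s))"
  shows "L holomorphic_on UNIV"
    and "L s = \<omega> * of_real Q powr (1 - 2 * s) * cnj (L (1 - cnj s))"
proof -
  obtain k F where F: "F holomorphic_on UNIV" "\<And>s. s \<noteq> 1 \<Longrightarrow> F s = (s - 1) ^ k * L s"
    and nice: "L nicely_meromorphic_on UNIV"
    using L unfolding extended_selberg_def entire_of_finite_order_def by blast
  define H where "H = (\<lambda>s. \<omega> * of_real Q powr (1 - 2 * s) * cnj (L (1 - cnj s)))"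
  have eq: "\<forall>\<^sub>\<approx>s. L s = H s"
    using fe
  proof eventually_elim
    case (elim s)
    have "cnj (of_real Q powr (1 - cnj s)) = of_real Q powr (1 - s)"
      using Q by (simp add: powr_def exp_cnj Ln_of_real)
    moreover have "of_real Q powr (1 - s) = of_real Q powr (1 - 2 * s) * of_real Q powr s"
      by (simp flip: powr_add)
    moreover have "of_real Q powr s \<noteq> (0::complex)" using Q by simp
    ultimately show ?case using elim by (simp add: H_def)
  qed
  have "(\<lambda>s. F s / (s - 1) ^ k) holomorphic_on (- {1})"
    using F(1) by (intro holomorphic_intros holomorphic_on_subset[OF F(1)]) auto
  also have "?this \<longleftrightarrow> L holomorphic_on (- {1})"
    using F(2) by (intro holomorphic_cong) auto
  finally have holL: "L holomorphic_on (- {1})" .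
  hence contL: "isCont L s" if "s \<noteq> 1" for s
    using that by (meson Compl_iff continuous_on_eq_continuous_at holomorphic_on_imp_continuous_on open_Compl closed_singleton singletonD)
  have contH: "isCont H s" if "isCont L (1 - cnj s)" for s
  proof -
    have "isCont (\<lambda>s. 1 - cnj s) s" by (intro continuous_intros)
    hence "isCont (\<lambda>s. L (1 - cnj s)) s" using that by (rule isCont_o2)
    moreover have "isCont (\<lambda>s. complex_of_real Q powr (1 - 2 * s)) s"
      using Q by (simp add: powr_def)
    ultimately show ?thesis unfolding H_def
      by (intro isCont_mult continuous_cnj continuous_const)
  qed
  have lim: "\<forall>\<^sub>F w in at s. L w = H w" for s
    using eventually_cosparse_imp_eventually_at[OF eq, of s UNIV] by simp
  have at_1: "L \<midarrow>1\<rightarrow> H 1"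
  proof -
    \<comment> \<open>Since \<open>1 - cnj 1 = 0\<close>, continuity of \<open>H\<close> at 1 comes
      from continuity of \<open>L\<close> at 0.\<close>
    have "H \<midarrow>1\<rightarrow> H 1" using contH[of 1] contL[of 0] by (simp add: isCont_def)
    thus ?thesis using tendsto_cong[OF lim] by blast
  qed
  have "\<not> is_pole L 1"
    using at_1 not_tendsto_and_filterlim_at_infinity[of "at (1::complex)" L "H 1"] by (auto simp: is_pole_def)
  hence "L analytic_on {1}" using nice by (intro nicely_meromorphic_on_imp_analytic_at) auto
  moreover have "L analytic_on (- {1})" using holL by (subst analytic_on_open) auto
  ultimately have "L analytic_on ({1} \<union> (- {1}))" by (subst analytic_on_Un) auto
  thus hol: "L holomorphic_on UNIV" using analytic_imp_holomorphic by (simp add: Compl_partition)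
  hence contL: "isCont L s" for s
    by (meson UNIV_I continuous_on_eq_continuous_at holomorphic_on_imp_continuous_on open_UNIV)
  have "L \<midarrow>s\<rightarrow> L s" "H \<midarrow>s\<rightarrow> H s"
    using contL contH[OF contL] by (auto simp: isCont_def)
  hence "L s = H s"
    using tendsto_cong[OF lim[of s]] LIM_unique by blast
  thus "L s = \<omega> * of_real Q powr (1 - 2 * s) * cnj (L (1 - cnj s))"
    by (simp add: H_def)
qed

text \<open>Once \<open>norm z \<ge> 2\<close>, the factor \<open>(z - 1) ^ k\<close> has norm at
  least 1, so the bound for \<open>F\<close> passes to \<open>L\<close> with the same
  exponent.\<close>

lemma degree_zero_growth:
  assumes L: "L \<in> extended_selberg"
  obtains \<rho> where "\<forall>\<^sub>F z in at_infinity. norm (L z) \<le> exp (norm z powr \<rho>)"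
proof -
  obtain k F \<rho> where F: "\<And>s. s \<noteq> 1 \<Longrightarrow> F s = (s - 1) ^ k * L s"
    and growth: "\<forall>\<^sub>F z in at_infinity. norm (F z) \<le> exp (norm z powr \<rho>)"
    using L unfolding extended_selberg_def entire_of_finite_order_def by blast
  have "\<forall>\<^sub>F z::complex in at_infinity. norm z \<ge> 2"
    by (auto simp: eventually_at_infinity)
  with growth have "\<forall>\<^sub>F z in at_infinity. norm (L z) \<le> exp (norm z powr \<rho>)"
  proof eventually_elim
    case (elim z)
    have "norm (z - 1) \<ge> 1" using norm_triangle_ineq2[of z 1] elim by auto
    hence "norm (L z) \<le> norm (z - 1) ^ k * norm (L z)"
      using mult_right_mono[of 1 "norm (z - 1) ^ k" "norm (L z)"] by simp
    also have "\<dots> = norm (F z)" using F[of z] elim by (cases "z = 1") (auto simp: norm_mult norm_power)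
    finally show ?case using elim by linarith
  qed
  thus ?thesis using that by blast
qed

text \<open>
  The two L-functions may be known to have degree zero only through functional equations without
  Gamma factors that differ from the common one. Dividing each by the common functional equation
  expresses the quotient of the common factors through the data of either.
\<close>

lemma degree_zero_data_unique:
  fixes Q1 Q2 :: real and \<omega>1 \<omega>2 :: complex
  assumes same: "same_functional_equation L1 L2"
    and Q: "Q1 > 0" "Q2 > 0" and \<omega>: "norm \<omega>1 = 1" "norm \<omega>2 = 1"
    and fe1: "\<And>s. L1 s = \<omega>1 * of_real Q1 powr (1 - 2 * s) * cnj (L1 (1 - cnj s))"
    and fe2: "\<And>s. L2 s = \<omega>2 * of_real Q2 powr (1 - 2 * s) * cnj (L2 (1 - cnj s))"
    and nz: "\<forall>\<^sub>F s in filtercomap Re at_top. L1 s \<noteq> 0" "\<forall>\<^sub>F s in filtercomap Re at_top. L2 s \<noteq> 0"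
  shows "Q1 = Q2" and "\<omega>1 = \<omega>2"
proof -
  obtain K Q lam nu \<omega> where fe: "functional_equation K Q lam nu \<omega> L1" "functional_equation K Q lam nu \<omega> L2"
    using same unfolding same_functional_equation_def by blast
  define g where "g = (\<lambda>s. of_real Q powr s * (\<Prod>j\<in>{1..K}. Gamma (of_real (lam j) * s + nu j)))"
  have compl: "completed_L K Q lam nu L s = L s * g s" for L s
    by (simp add: completed_L_def g_def mult.assoc)
  have ev: "\<forall>\<^sub>\<approx>s. L1 s * g s = \<omega> * cnj (L1 (1 - cnj s)) * cnj (g (1 - cnj s)) \<and>
      L2 s * g s = \<omega> * cnj (L2 (1 - cnj s)) * cnj (g (1 - cnj s))"
    using fe unfolding functional_equation_def compl by (intro eventually_conj) (auto simp: mult.assoc)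
  have pos: "Q > 0" "\<And>j. j \<in> {1..K} \<Longrightarrow> lam j > 0 \<and> Re (nu j) \<ge> 0"
    using fe(1) unfolding functional_equation_def by auto
  \<comment> \<open>For \<open>Re s > 0\<close> every Gamma argument has positive real part and so
    misses the poles, the only places where \<open>Gamma\<close> takes the value 0 in HOL.\<close>
  have g_nz: "g s \<noteq> 0" if "Re s > 0" for s
  proof -
    have "Gamma (of_real (lam j) * s + nu j) \<noteq> 0" if "j \<in> {1..K}" for j
    proof -
      have "Re (of_real (lam j) * s + nu j) > 0"
        using pos(2)[OF that] \<open>Re s > 0\<close> by (simp add: add_pos_nonneg)
      hence "of_real (lam j) * s + nu j \<notin> \<int>\<^sub>\<le>\<^sub>0" by (metis complex_nonpos_Reals_iff nonpos_Ints_subset_nonpos_Reals not_le subsetD)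
      thus ?thesis by (simp add: Gamma_eq_zero_iff)
    qed
    thus ?thesis using pos(1) by (simp add: g_def)
  qed
  obtain x where x: "\<And>s. Re s \<ge> x \<Longrightarrow> L1 s \<noteq> 0 \<and> L2 s \<noteq> 0"
    using eventually_conj[OF nz] unfolding eventually_filtercomap_at_top_linorder by blast
  \<comment> \<open>The common equation is known only off a sparse set. Some point near
    \<open>s0\<close> satisfies it and lies where \<open>L1\<close>, \<open>L2\<close> and
    \<open>g\<close> are all nonzero.\<close>
  define s0 :: complex where "s0 = of_real (max x 1 + 1)"
  have "\<forall>\<^sub>F s in at s0. s \<in> {s. Re s > max x 1}"
    by (intro eventually_at_in_open') (simp_all add: s0_def open_halfspace_Re_gt del: max_less_iff_conj)
  from eventually_happens'[OF _ eventually_conj[OF this eventually_cosparse_imp_eventually_at[OF ev UNIV_I]]]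
  obtain s where s: "Re s > max x 1"
    "L1 s * g s = \<omega> * cnj (L1 (1 - cnj s)) * cnj (g (1 - cnj s))"
    "L2 s * g s = \<omega> * cnj (L2 (1 - cnj s)) * cnj (g (1 - cnj s))"
    by auto
  define G where "G = \<omega> * cnj (g (1 - cnj s))"
  \<comment> \<open>The factor \<open>cnj (L (1 - cnj s))\<close> is nonzero because
    \<open>L s\<close> is, and cancelling it leaves an expression for \<open>G\<close> free of
    \<open>L\<close>.\<close>
  have quot: "G = w * of_real q powr (1 - 2 * s) * g s"
    if "L s * g s = \<omega> * cnj (L (1 - cnj s)) * cnj (g (1 - cnj s))" "L s \<noteq> 0"
      "L s = w * of_real q powr (1 - 2 * s) * cnj (L (1 - cnj s))" for L w and q :: real
  proof -
    have "cnj (L (1 - cnj s)) \<noteq> 0" using that(2,3) by (metis mult_zero_right)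
    moreover have "cnj (L (1 - cnj s)) * G = cnj (L (1 - cnj s)) * (w * of_real q powr (1 - 2 * s) * g s)"
      using that(1) arg_cong[OF that(3), of "\<lambda>u. u * g s"] unfolding G_def
      by (simp only: mult_ac)
    ultimately show ?thesis by simp
  qed
  have "G = \<omega>1 * of_real Q1 powr (1 - 2 * s) * g s" "G = \<omega>2 * of_real Q2 powr (1 - 2 * s) * g s"
    using quot[of L1 \<omega>1 Q1, OF s(2) _ fe1] quot[of L2 \<omega>2 Q2, OF s(3) _ fe2] x[of s] s(1) by simp_all
  moreover have "g s \<noteq> 0" using s(1) by (intro g_nz) auto
  ultimately have eq: "\<omega>1 * of_real Q1 powr (1 - 2 * s) = \<omega>2 * of_real Q2 powr (1 - 2 * s)"
    by auto
  \<comment> \<open>Taking moduli removes the unit factors; since \<open>Re s > 1\<close>, the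
    exponent \<open>1 - 2 * Re s\<close> is nonzero and the bases must agree.\<close>
  hence "norm (\<omega>1 * of_real Q1 powr (1 - 2 * s)) = norm (\<omega>2 * of_real Q2 powr (1 - 2 * s))" by simp
  hence "Q1 powr (1 - 2 * Re s) = Q2 powr (1 - 2 * Re s)"
    using Q \<omega> by (simp add: norm_mult norm_powr_real_powr)
  hence "(1 - 2 * Re s) * ln Q1 = (1 - 2 * Re s) * ln Q2"
    using Q ln_powr[of Q1 "1 - 2 * Re s"] ln_powr[of Q2 "1 - 2 * Re s"] by auto
  thus "Q1 = Q2" using Q s(1) by simp
  thus "\<omega>1 = \<omega>2" using eq Q by simp
qed

section \<open>Behaviour on the left and in vertical strips\<close>

lemma filtercomap_Re_neq_bot: "filtercomap Re at_bot \<noteq> bot"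
  by (rule filtercomap_neq_bot_surj) (auto intro!: surjI[of _ of_real])

text \<open>By the functional equation the quotient is \<open>cnj (L (1 - cnj s))\<close>, and
  reflection carries the far left to the far right, where \<open>L\<close> tends to its first
  coefficient.\<close>

lemma degree_zero_tendsto_left:
  fixes Q :: real
  assumes Q: "Q > 0" "norm \<omega> = 1"
    and fe: "\<And>s. L s = \<omega> * of_real Q powr (1 - 2 * s) * cnj (L (1 - cnj s))"
    and D: "dirichlet_series_of a L" "a 1 = 1"
  shows "((\<lambda>s. L s / (\<omega> * of_real Q powr (1 - 2 * s))) \<longlongrightarrow> 1) (filtercomap Re at_bot)"
proof -
  have "filterlim (\<lambda>x::real. 1 - x) at_top at_bot" by real_asymp
  hence "filterlim (\<lambda>s. 1 - Re s) at_top (filtercomap Re at_bot)"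
    by (rule filterlim_compose[OF _ filterlim_filtercomap])
  hence "filterlim (\<lambda>s. 1 - cnj s) (filtercomap Re at_top) (filtercomap Re at_bot)"
    by (simp add: filterlim_filtercomap_iff o_def)
  from filterlim_compose[OF dirichlet_series_tendsto_first_coeff[OF D(1)] this]
  have "((\<lambda>s. cnj (L (1 - cnj s))) \<longlongrightarrow> cnj 1) (filtercomap Re at_bot)"
    using D(2) by (intro tendsto_cnj) simp
  moreover have "L s / (\<omega> * of_real Q powr (1 - 2 * s)) = cnj (L (1 - cnj s))" for s
  proof -
    have "\<omega> * of_real Q powr (1 - 2 * s) \<noteq> 0" using Q by auto
    thus ?thesis using arg_cong[OF fe[of s], of "\<lambda>u. u / (\<omega> * of_real Q powr (1 - 2 * s))"] by simp
  qed
  ultimately show ?thesis by simp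
qed

text \<open>The series bounds \<open>L\<close> on \<open>Re s \<ge> 2\<close>, and reflection
  transfers this to \<open>Re s \<le> -1\<close>. The strip between these two mutually reflected
  lines is filled by Phragmen-Lindelof.\<close>

lemma degree_zero_bounds:
  fixes Q :: real
  assumes hol: "L holomorphic_on UNIV"
    and growth: "\<forall>\<^sub>F z in at_infinity. norm (L z) \<le> exp (norm z powr \<rho>)"
    and Q: "Q > 0" "norm \<omega> = 1"
    and fe: "\<And>s. L s = \<omega> * of_real Q powr (1 - 2 * s) * cnj (L (1 - cnj s))"
    and D: "dirichlet_series_of a L"
  obtains M where "M > 0" "\<And>z. Re z \<ge> -1 \<Longrightarrow> norm (L z) \<le> M"
    "\<And>z. Re z \<le> -1 \<Longrightarrow> norm (L z) \<le> Q powr (1 - 2 * Re z) * M"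
proof -
  obtain C where C: "C \<ge> 0"
    "\<And>s. Re s \<ge> 2 \<Longrightarrow> norm (L s - a 1 * of_nat 1 powr (-s)) \<le> C * real (1 + 1) powr (- Re s)"
    using dirichlet_series_leading_term[OF D, of 1] by auto
  define K where "K = norm (a 1) + C + 1"
  have K: "K > 0" using C by (simp add: K_def add_nonneg_pos)
  have right: "norm (L s) \<le> K" if "Re s \<ge> 2" for s
  proof -
    have "norm (L s - a 1) \<le> C * 2 powr (- Re s)" using C(2)[OF that] by simp
    also have "\<dots> \<le> C * 1" using C that powr_mono[of "- Re s" 0 2] by (intro mult_left_mono) auto
    finally show ?thesis using norm_triangle_sub[of "L s" "a 1"] by (simp add: K_def)
  qed
  have left: "norm (L s) \<le> Q powr (1 - 2 * Re s) * K" if "Re s \<le> -1" for s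
  proof -
    have "norm (L s) = Q powr (1 - 2 * Re s) * norm (L (1 - cnj s))"
      by (subst fe) (use Q in \<open>simp add: norm_mult norm_powr_real_powr\<close>)
    also have "\<dots> \<le> Q powr (1 - 2 * Re s) * K"
      using that by (intro mult_left_mono right) auto
    finally show ?thesis .
  qed
  \<comment> \<open>\<open>Q powr 3\<close> is the value of \<open>Q powr (1 - 2 * Re s)\<close> on
    the line \<open>Re s = -1\<close>.\<close>
  define M where "M = max K (Q powr 3 * K)"
  have M: "M > 0" using K by (simp add: M_def)
  have "norm (L z) \<le> M" if "-1 \<le> Re z" "Re z \<le> 2" for z
  proof (rule phragmen_lindelof_strip[OF hol _ M _ growth that])
    show "norm (L z) \<le> M" if "Re z = -1 \<or> Re z = 2" for z
      using that left[of z] right[of z] by (auto simp: M_def)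
  qed auto
  moreover have "norm (L z) \<le> M" if "Re z \<ge> 2" for z
    using right[OF that] by (simp add: M_def)
  ultimately have "norm (L z) \<le> M" if "Re z \<ge> -1" for z
    using that by (cases "Re z \<le> 2") auto
  moreover have "norm (L z) \<le> Q powr (1 - 2 * Re z) * M" if "Re z \<le> -1" for z
    using left[OF that] by (rule order_trans) (auto simp: M_def intro: mult_left_mono)
  ultimately show ?thesis using M that by blast
qed

lemma degree_zero_conductor_gt_1:
  fixes Q :: real
  assumes hol: "L holomorphic_on UNIV" and nonconst: "\<not> L constant_on UNIV"
    and growth: "\<forall>\<^sub>F z in at_infinity. norm (L z) \<le> exp (norm z powr \<rho>)"
    and Q: "Q > 0" "norm \<omega> = 1"
    and fe: "\<And>s. L s = \<omega> * of_real Q powr (1 - 2 * s) * cnj (L (1 - cnj s))"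
    and D: "dirichlet_series_of a L"
  shows "Q > 1"
proof (rule ccontr)
  assume "\<not> Q > 1"
  obtain M where M: "M > 0" "\<And>z. Re z \<ge> -1 \<Longrightarrow> norm (L z) \<le> M"
    "\<And>z. Re z \<le> -1 \<Longrightarrow> norm (L z) \<le> Q powr (1 - 2 * Re z) * M"
    using degree_zero_bounds[OF hol growth Q fe D] by blast
  have "norm (L z) \<le> M" for z
  proof (cases "Re z \<ge> -1")
    case False
    have "Q powr (1 - 2 * Re z) \<le> 1"
      using \<open>\<not> Q > 1\<close> Q False by (intro powr_le1) auto
    hence "Q powr (1 - 2 * Re z) * M \<le> 1 * M" using M(1) by (intro mult_right_mono) auto
    thus ?thesis using M(3)[of z] False by auto
  qed (use M in auto)
  hence "bounded (range L)" by (auto simp: bounded_iff)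
  thus False using Liouville_theorem[OF hol] nonconst by blast
qed

lemma degree_zero_bounded_on_strip:
  fixes Q :: real
  assumes hol: "L holomorphic_on UNIV"
    and growth: "\<forall>\<^sub>F z in at_infinity. norm (L z) \<le> exp (norm z powr \<rho>)"
    and Q: "Q > 1" "norm \<omega> = 1"
    and fe: "\<And>s. L s = \<omega> * of_real Q powr (1 - 2 * s) * cnj (L (1 - cnj s))"
    and D: "dirichlet_series_of a L"
  shows "\<exists>M. \<forall>z. \<bar>Re z\<bar> \<le> b \<longrightarrow> norm (L z) \<le> M"
proof -
  have "Q > 0" using Q by simp
  obtain M where M: "M > 0" "\<And>z. Re z \<ge> -1 \<Longrightarrow> norm (L z) \<le> M"
    "\<And>z. Re z \<le> -1 \<Longrightarrow> norm (L z) \<le> Q powr (1 - 2 * Re z) * M"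
    using degree_zero_bounds[OF hol growth \<open>Q > 0\<close> Q(2) fe D] by blast
  have "norm (L z) \<le> max M (Q powr (1 + 2 * b) * M)" if "\<bar>Re z\<bar> \<le> b" for z
  proof (cases "Re z \<ge> -1")
    case False
    have "Q powr (1 - 2 * Re z) * M \<le> Q powr (1 + 2 * b) * M"
      using Q M(1) that by (intro mult_right_mono powr_mono) auto
    thus ?thesis using M(3)[of z] False by auto
  qed (use M in \<open>auto intro: max.coboundedI1\<close>)
  thus ?thesis by blast
qed

section \<open>Products over the shared set\<close>

lemma prod_diff_bounded_on_strip:
  fixes f :: "complex \<Rightarrow> complex"
  assumes "\<And>b. \<exists>M. \<forall>z. \<bar>Re z\<bar> \<le> b \<longrightarrow> norm (f z) \<le> M"
  shows "\<exists>M. \<forall>z. \<bar>Re z\<bar> \<le> b \<longrightarrow> norm (\<Prod>\<alpha>\<in>S. f z - \<alpha>) \<le> M"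
proof -
  obtain M where M: "\<And>z. \<bar>Re z\<bar> \<le> b \<Longrightarrow> norm (f z) \<le> M" using assms by blast
  have "norm (\<Prod>\<alpha>\<in>S. f z - \<alpha>) \<le> (\<Prod>\<alpha>\<in>S. M + norm \<alpha>)" if "\<bar>Re z\<bar> \<le> b" for z
    unfolding prod_norm[symmetric]
    using M[OF that] by (intro prod_mono) (auto intro!: order_trans[OF norm_triangle_ineq4])
  thus ?thesis by blast
qed

text \<open>Distributing the power of \<open>X s\<close> over the product turns each factor into
  \<open>f s / X s - \<alpha> / X s\<close>, which tends to 1.\<close>

lemma tendsto_prod_diff_over_power:
  fixes f X :: "'a \<Rightarrow> complex"
  assumes f: "((\<lambda>s. f s / X s) \<longlongrightarrow> 1) T" and X: "((\<lambda>s. inverse (X s)) \<longlongrightarrow> 0) T"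
  shows "((\<lambda>s. (\<Prod>\<alpha>\<in>S. f s - \<alpha>) / X s ^ card S) \<longlongrightarrow> 1) T"
proof -
  have "((\<lambda>s. \<Prod>\<alpha>\<in>S. f s / X s - \<alpha> * inverse (X s)) \<longlongrightarrow> (\<Prod>\<alpha>\<in>S. 1 - \<alpha> * 0)) T"
    by (intro tendsto_intros f X)
  moreover have "(\<Prod>\<alpha>\<in>S. f s / X s - \<alpha> * inverse (X s)) = (\<Prod>\<alpha>\<in>S. f s - \<alpha>) / X s ^ card S" for s
    by (simp add: prod_dividef flip: divide_inverse diff_divide_distrib)
  ultimately show ?thesis by simp
qed

text \<open>\<open>R\<close> is the divided difference of the polynomial with zero set
  \<open>S\<close>, built by adding one root at a time; each root adds 1 to the limit. Writing
  \<open>R s * X s / X s ^ card S\<close> in place of a division by the power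
  \<open>card S - 1\<close> keeps the empty set as a valid base case.\<close>

lemma prod_diff_factor:
  fixes f g X :: "'a \<Rightarrow> complex"
  assumes S: "finite S"
    and f: "((\<lambda>s. f s / X s) \<longlongrightarrow> 1) T" and g: "((\<lambda>s. g s / X s) \<longlongrightarrow> 1) T"
    and X: "((\<lambda>s. inverse (X s)) \<longlongrightarrow> 0) T" "\<And>s. X s \<noteq> 0"
  shows "\<exists>R. (\<forall>s. (\<Prod>\<alpha>\<in>S. f s - \<alpha>) - (\<Prod>\<alpha>\<in>S. g s - \<alpha>) = (f s - g s) * R s) \<and>
    ((\<lambda>s. R s * X s / X s ^ card S) \<longlongrightarrow> of_nat (card S)) T"
  using S
proof (induction S rule: finite_induct)
  case empty
  show ?case by (intro exI[of _ "\<lambda>_. 0"]) auto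
next
  case (insert x S)
  then obtain R where R: "\<And>s. (\<Prod>\<alpha>\<in>S. f s - \<alpha>) - (\<Prod>\<alpha>\<in>S. g s - \<alpha>) = (f s - g s) * R s"
    "((\<lambda>s. R s * X s / X s ^ card S) \<longlongrightarrow> of_nat (card S)) T" by blast
  define R' where "R' = (\<lambda>s. (f s - x) * R s + (\<Prod>\<alpha>\<in>S. g s - \<alpha>))"
  have "(\<Prod>\<alpha>\<in>insert x S. f s - \<alpha>) - (\<Prod>\<alpha>\<in>insert x S. g s - \<alpha>) = (f s - g s) * R' s" for s
  proof -
    have "(\<Prod>\<alpha>\<in>insert x S. f s - \<alpha>) - (\<Prod>\<alpha>\<in>insert x S. g s - \<alpha>) =
        (f s - x) * ((\<Prod>\<alpha>\<in>S. f s - \<alpha>) - (\<Prod>\<alpha>\<in>S. g s - \<alpha>)) + (f s - g s) * (\<Prod>\<alpha>\<in>S. g s - \<alpha>)"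
      using insert by (simp add: algebra_simps)
    thus ?thesis unfolding R(1) R'_def by (simp add: algebra_simps)
  qed
  moreover have "((\<lambda>s. R' s * X s / X s ^ card (insert x S)) \<longlongrightarrow> of_nat (card (insert x S))) T"
  proof -
    have "((\<lambda>s. (f s / X s - x * inverse (X s)) * (R s * X s / X s ^ card S) +
        (\<Prod>\<alpha>\<in>S. g s - \<alpha>) / X s ^ card S) \<longlongrightarrow> (1 - x * 0) * of_nat (card S) + 1) T"
      by (intro tendsto_intros f R(2) X(1) tendsto_prod_diff_over_power g)
    also have "(\<lambda>s. (f s / X s - x * inverse (X s)) * (R s * X s / X s ^ card S) +
        (\<Prod>\<alpha>\<in>S. g s - \<alpha>) / X s ^ card S) = (\<lambda>s. R' s * X s / X s ^ card (insert x S))"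
      using insert X(2) by (auto simp: R'_def fun_eq_iff field_simps)
    finally show ?thesis using insert by (simp add: add.commute)
  qed
  ultimately show ?case by blast
qed

section \<open>Liouville's theorem for the quotient\<close>

text \<open>On the left \<open>E\<close> tends to 1. On the right \<open>k \<le> m\<close> means
  that \<open>F\<close> decays at least as fast as \<open>G\<close>, so \<open>E\<close> is bounded
  there; between the two, the strip lemma applies. By Liouville \<open>E\<close> is constant, and
  its limit on the left identifies the constant as 1.\<close>

lemma entire_quotient_eq_one:
  assumes hol: "E holomorphic_on UNIV" "G holomorphic_on UNIV"
    and FEG: "\<And>z. F z = E z * G z"
    and bF: "\<And>b. \<exists>M. \<forall>z. \<bar>Re z\<bar> \<le> b \<longrightarrow> norm (F z) \<le> M"
    and bG: "\<And>b. \<exists>M. \<forall>z. \<bar>Re z\<bar> \<le> b \<longrightarrow> norm (G z) \<le> M"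
    and dF: "exact_decay F m" and dG: "exact_decay G k" and km: "k \<le> m"
    and lF: "((\<lambda>s. F s / Y s) \<longlongrightarrow> 1) (filtercomap Re at_bot)"
    and lG: "((\<lambda>s. G s / Y s) \<longlongrightarrow> 1) (filtercomap Re at_bot)"
    and Y: "\<forall>\<^sub>F s in filtercomap Re at_bot. norm (Y s) \<ge> 1"
  shows "F z = G z"
proof -
  have G_large: "\<forall>\<^sub>F s in filtercomap Re at_bot. norm (G s) \<ge> 1/2"
  proof -
    have "\<forall>\<^sub>F s in filtercomap Re at_bot. norm (G s / Y s) > 1/2"
      using tendsto_norm[OF lG] by (rule order_tendstoD) auto
    thus ?thesis using Y
    proof eventually_elim
      case (elim s)
      hence "0 < norm (Y s)" "1/2 < norm (G s) / norm (Y s)" by (auto simp: norm_divide)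
      hence "1/2 * norm (Y s) < norm (G s)" by (simp only: pos_less_divide_eq)
      thus ?case using elim by linarith
    qed
  qed
  have "((\<lambda>s. (F s / Y s) / (G s / Y s)) \<longlongrightarrow> 1 / 1) (filtercomap Re at_bot)"
    by (intro tendsto_intros lF lG) auto
  moreover have "\<forall>\<^sub>F s in filtercomap Re at_bot. (F s / Y s) / (G s / Y s) = E s"
    using G_large Y by eventually_elim (auto simp: FEG)
  ultimately have lE: "(E \<longlongrightarrow> 1) (filtercomap Re at_bot)"
    using tendsto_cong by force
  hence "\<forall>\<^sub>F s in filtercomap Re at_bot. norm (E s) < 2"
    using tendsto_norm[OF lE] by (intro order_tendstoD(2)) auto
  then obtain A where A: "\<And>s. Re s \<le> A \<Longrightarrow> norm (E s) < 2"
    by (auto simp: eventually_filtercomap_at_bot_linorder)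
  from dF dG obtain c C d D where pos: "m > 0" "k > 0" "C > 0" "d > 0" and
    ev: "\<forall>\<^sub>F s in filtercomap Re at_top. norm (F s) \<le> C * m powr (- Re s)"
    "\<forall>\<^sub>F s in filtercomap Re at_top. d * k powr (- Re s) \<le> norm (G s)"
    unfolding exact_decay_def by (auto simp: eventually_conj_iff)
  have "\<forall>\<^sub>F s in filtercomap Re at_top. Re s \<ge> 0"
    by (auto simp: eventually_filtercomap_at_top_linorder)
  with ev have "\<forall>\<^sub>F s in filtercomap Re at_top. norm (E s) \<le> C / d"
  proof eventually_elim
    case (elim s)
    have "norm (E s) * (d * k powr (- Re s)) \<le> norm (E s) * norm (G s)"
      using elim by (intro mult_left_mono) auto
    also have "\<dots> = norm (F s)" by (simp add: FEG norm_mult)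
    also have "\<dots> \<le> C * m powr (- Re s)" by (rule elim)
    also have "\<dots> \<le> C * k powr (- Re s)"
      using pos km elim by (intro mult_left_mono powr_mono2') auto
    finally have "norm (E s) * d * k powr (- Re s) \<le> C * k powr (- Re s)" by (simp add: mult.assoc)
    hence "norm (E s) * d \<le> C" using pos by simp
    thus ?case using pos by (simp add: field_simps)
  qed
  then obtain B where B: "\<And>s. Re s \<ge> B \<Longrightarrow> norm (E s) \<le> C / d"
    by (auto simp: eventually_filtercomap_at_top_linorder)
  \<comment> \<open>A vertical line far to the left supplies the lower bound on \<open>G\<close>
    that the strip lemma asks for.\<close>
  obtain x0 where x0: "\<And>s. Re s \<le> x0 \<Longrightarrow> norm (G s) \<ge> 1/2"
    using G_large by (auto simp: eventually_filtercomap_at_bot_linorder)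
  obtain M where M: "\<And>z. \<bar>Re z\<bar> \<le> max \<bar>A\<bar> \<bar>B\<bar> \<Longrightarrow> norm (E z) \<le> M"
    using bounded_quotient_on_strip[OF hol FEG bF bG, of "1/2" x0 "max \<bar>A\<bar> \<bar>B\<bar>"] x0 by auto
  have "norm (E z) \<le> max 2 (max (C / d) M)" for z
  proof -
    consider "Re z \<le> A" | "Re z \<ge> B" | "\<bar>Re z\<bar> \<le> max \<bar>A\<bar> \<bar>B\<bar>" by linarith
    thus ?thesis by cases (use A[of z] B[of z] M[of z] in auto)
  qed
  hence "bounded (range E)" by (auto simp: bounded_iff)
  hence "E constant_on UNIV" by (rule Liouville_theorem[OF hol(1)])
  then obtain e where e: "\<And>z. E z = e" by (auto simp: constant_on_def)
  have "E = (\<lambda>_. e)" by (simp add: fun_eq_iff e)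
  with lE have "((\<lambda>_. e) \<longlongrightarrow> 1) (filtercomap Re at_bot)" by simp
  hence "e = 1" by (simp add: tendsto_const_iff filtercomap_Re_neq_bot)
  thus ?thesis by (simp add: FEG e)
qed

text \<open>This is the identity theorem, applied from the region of the Dirichlet series and, after
  \<open>s\<close> is replaced by \<open>-s\<close>, from a left half plane.\<close>

lemma entire_constant_on_half_plane:
  assumes hol: "f holomorphic_on UNIV" and eq: "\<And>s. Re s > x \<Longrightarrow> f s = c"
  shows "f s = c"
proof -
  define H where "H = {s::complex. Re s > x}"
  have "open H" unfolding H_def by (rule open_halfspace_Re_gt)
  moreover have "of_real (x + 1) \<in> H" by (simp add: H_def)
  ultimately have "of_real (x + 1) islimpt H"
    by (intro interior_limit_point) (simp add: interior_open)
  hence "f s - c = 0"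
    by (intro analytic_continuation[of "\<lambda>s. f s - c" UNIV H "of_real (x + 1)" s] holomorphic_intros hol)
       (auto simp: H_def eq)
  thus ?thesis by simp
qed

text \<open>No factor \<open>L s - \<alpha>\<close> vanishes throughout \<open>Re s > 1\<close>, for
  then \<open>L\<close> would be constant. Each factor thus has a leading Dirichlet term, and the
  decay rates multiply.\<close>

lemma exact_decay_prod_diff:
  assumes hol: "L holomorphic_on UNIV" and nonconst: "\<not> L constant_on UNIV"
    and D: "dirichlet_series_of a L"
  shows "\<exists>m. exact_decay (\<lambda>s. \<Prod>\<alpha>\<in>S. L s - \<alpha>) m"
proof (rule exact_decay_prod[where f = "\<lambda>\<alpha> s. L s - \<alpha>"])
  fix \<alpha>
  have "\<exists>s. Re s > 1 \<and> L s - \<alpha> \<noteq> 0"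
  proof (rule ccontr)
    assume "\<not> ?thesis"
    hence *: "L s = \<alpha>" if "Re s > 1" for s using that by auto
    have "L s = \<alpha>" for s using * by (rule entire_constant_on_half_plane[OF hol])
    thus False using nonconst by (auto simp: constant_on_def)
  qed
  thus "\<exists>m. exact_decay (\<lambda>s. L s - \<alpha>) m"
    using dirichlet_series_exact_decay[OF dirichlet_series_diff_const[OF D]] by blast
qed

section \<open>Equality of two degree-zero L-functions sharing a set\<close>

theorem theorem1p2:
  fixes L1 L2 :: "complex \<Rightarrow> complex" and a1 a2 :: "nat \<Rightarrow> complex"
    and n :: nat and S :: "complex set"
  assumes "L1 \<in> extended_selberg" and "L2 \<in> extended_selberg"
    and "\<not> L1 constant_on UNIV" and "\<not> L2 constant_on UNIV"
    and "selberg_degree L1 = 0" and "selberg_degree L2 = 0"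
    and "same_functional_equation L1 L2"
    and "dirichlet_series_of a1 L1" and "dirichlet_series_of a2 L2"
    and "a1 1 = 1" and "a2 1 = 1"
    and "n \<ge> 1" and "finite S" and "card S = n"
    and "share_set_CM L1 L2 S"
  shows "L1 = L2"
proof -
  obtain Q \<omega> where Q: "Q > 0" "norm \<omega> = 1" and ev1:
    "\<forall>\<^sub>\<approx>s. L1 s * of_real Q powr s = \<omega> * cnj (L1 (1 - cnj s) * of_real Q powr (1 - cnj s))"
    using degree_zero_functional_equation[OF assms(1,5)] by blast
  obtain Q' \<omega>' where Q': "Q' > 0" "norm \<omega>' = 1" and ev2:
    "\<forall>\<^sub>\<approx>s. L2 s * of_real Q' powr s = \<omega>' * cnj (L2 (1 - cnj s) * of_real Q' powr (1 - cnj s))"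
    using degree_zero_functional_equation[OF assms(2,6)] by blast
  note hol1 = degree_zero_entire(1)[OF assms(1) Q(1) ev1] and fe1 = degree_zero_entire(2)[OF assms(1) Q(1) ev1]
  note hol2 = degree_zero_entire(1)[OF assms(2) Q'(1) ev2] and fe2' = degree_zero_entire(2)[OF assms(2) Q'(1) ev2]
  \<comment> \<open>First coefficient 1 makes both functions nonzero far to the right, which allows
    their separately obtained data to be compared.\<close>
  have "\<forall>\<^sub>F s in filtercomap Re at_top. L1 s \<noteq> 0"
    using tendsto_imp_eventually_ne[OF dirichlet_series_tendsto_first_coeff[OF assms(8)], of 0] assms(10)
    by simp
  moreover have "\<forall>\<^sub>F s in filtercomap Re at_top. L2 s \<noteq> 0"
    using tendsto_imp_eventually_ne[OF dirichlet_series_tendsto_first_coeff[OF assms(9)], of 0] assms(11)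
    by simp
  ultimately have "Q = Q'" "\<omega> = \<omega>'"
    using degree_zero_data_unique[OF assms(7) Q(1) Q'(1) Q(2) Q'(2) fe1 fe2'] by blast+
  hence fe2: "L2 s = \<omega> * of_real Q powr (1 - 2 * s) * cnj (L2 (1 - cnj s))" for s
    using fe2' by blast
  obtain \<rho>1 where gr1: "\<forall>\<^sub>F z in at_infinity. norm (L1 z) \<le> exp (norm z powr \<rho>1)"
    using degree_zero_growth[OF assms(1)] by blast
  obtain \<rho>2 where gr2: "\<forall>\<^sub>F z in at_infinity. norm (L2 z) \<le> exp (norm z powr \<rho>2)"
    using degree_zero_growth[OF assms(2)] by blast
  have Q1: "Q > 1"
    by (rule degree_zero_conductor_gt_1[OF hol1 assms(3) gr1 Q fe1 assms(8)])

  define X where "X = (\<lambda>s. \<omega> * of_real Q powr (1 - 2 * s))"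
  have norm_X: "norm (X s) = Q powr (1 - 2 * Re s)" for s
    using Q by (simp add: X_def norm_mult norm_powr_real_powr)
  have X_nz: "X s \<noteq> 0" for s
    using Q by (auto simp: X_def)
  have "ln Q > 0" using Q1 by simp
  hence "((\<lambda>x. exp ((2 * x - 1) * ln Q)) \<longlongrightarrow> 0) at_bot"
    by real_asymp
  hence "((\<lambda>x. Q powr (2 * x - 1)) \<longlongrightarrow> 0) at_bot"
    using Q1 by (simp add: powr_def)
  hence "((\<lambda>s. Q powr (2 * Re s - 1)) \<longlongrightarrow> 0) (filtercomap Re at_bot)"
    by (rule filterlim_compose[OF _ filterlim_filtercomap])
  also have "(\<lambda>s. Q powr (2 * Re s - 1)) = (\<lambda>s. norm (inverse (X s)))"
    by (auto simp: norm_inverse norm_X fun_eq_iff simp flip: powr_minus)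
  finally have inv_X: "((\<lambda>s. inverse (X s)) \<longlongrightarrow> 0) (filtercomap Re at_bot)"
    by (simp only: tendsto_norm_zero_iff)
  have X_ge_1: "\<forall>\<^sub>F s in filtercomap Re at_bot. norm (X s ^ n) \<ge> 1"
  proof -
    have "norm (X s ^ n) \<ge> 1" if "Re s \<le> 0" for s
      unfolding norm_power norm_X using that Q1 by (intro one_le_power ge_one_powr_ge_zero) auto
    thus ?thesis by (auto simp: eventually_filtercomap_at_bot_linorder)
  qed
  have left1: "((\<lambda>s. L1 s / X s) \<longlongrightarrow> 1) (filtercomap Re at_bot)"
    unfolding X_def by (rule degree_zero_tendsto_left[OF Q fe1 assms(8,10)])
  have left2: "((\<lambda>s. L2 s / X s) \<longlongrightarrow> 1) (filtercomap Re at_bot)"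
    unfolding X_def by (rule degree_zero_tendsto_left[OF Q fe2 assms(9,11)])

  define F where "F = (\<lambda>s. \<Prod>\<alpha>\<in>S. L1 s - \<alpha>)"
  define G where "G = (\<lambda>s. \<Prod>\<alpha>\<in>S. L2 s - \<alpha>)"
  have hol: "F holomorphic_on UNIV" "G holomorphic_on UNIV"
    unfolding F_def G_def by (intro holomorphic_intros hol1 hol2)+
  have bF: "\<exists>M. \<forall>z. \<bar>Re z\<bar> \<le> b \<longrightarrow> norm (F z) \<le> M" for b
    unfolding F_def
    by (intro prod_diff_bounded_on_strip degree_zero_bounded_on_strip[OF hol1 gr1 Q1 Q(2) fe1 assms(8)])
  have bG: "\<exists>M. \<forall>z. \<bar>Re z\<bar> \<le> b \<longrightarrow> norm (G z) \<le> M" for b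
    unfolding G_def
    by (intro prod_diff_bounded_on_strip degree_zero_bounded_on_strip[OF hol2 gr2 Q1 Q(2) fe2 assms(9)])
  obtain m where dF: "exact_decay F m"
    using exact_decay_prod_diff[OF hol1 assms(3,8)] unfolding F_def by blast
  obtain k where dG: "exact_decay G k"
    using exact_decay_prod_diff[OF hol2 assms(4,9)] unfolding G_def by blast
  have lF: "((\<lambda>s. F s / X s ^ n) \<longlongrightarrow> 1) (filtercomap Re at_bot)"
    using tendsto_prod_diff_over_power[OF left1 inv_X, of S] assms(14) by (simp add: F_def)
  have lG: "((\<lambda>s. G s / X s ^ n) \<longlongrightarrow> 1) (filtercomap Re at_bot)"
    using tendsto_prod_diff_over_power[OF left2 inv_X, of S] assms(14) by (simp add: G_def)
  have nz: "\<exists>z. H z \<noteq> 0" if "((\<lambda>s. H s / X s ^ n) \<longlongrightarrow> 1) (filtercomap Re at_bot)" for H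
  proof (rule ccontr)
    assume "\<nexists>z. H z \<noteq> 0"
    hence "((\<lambda>_. 0) \<longlongrightarrow> (1::complex)) (filtercomap Re at_bot)" using that by simp
    thus False by (simp add: tendsto_const_iff filtercomap_Re_neq_bot)
  qed
  have same: "same_zeros_CM F G" "same_zeros_CM G F"
    using assms(15) unfolding share_set_CM_def F_def G_def same_zeros_CM_def by auto
  have FG: "F z = G z" for z
  \<comment> \<open>The quotient is formed in the direction that stays bounded on the right:
    \<open>F / G\<close> if \<open>F\<close> decays at least as fast, and \<open>G / F\<close>
    otherwise.\<close>
  proof (cases "k \<le> m")
    case True
    obtain E where E: "E holomorphic_on UNIV" "\<And>z. F z = E z * G z"
      using entire_quotient_of_same_zeros[OF hol nz[OF lF] nz[OF lG] same(1)] by blast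
    show ?thesis
      by (rule entire_quotient_eq_one[OF E(1) hol(2) E(2) bF bG dF dG True lF lG X_ge_1])
  next
    case False
    obtain E where E: "E holomorphic_on UNIV" "\<And>z. G z = E z * F z"
      using entire_quotient_of_same_zeros[OF hol(2,1) nz[OF lG] nz[OF lF] same(2)] by blast
    have "m \<le> k" using False by simp
    from entire_quotient_eq_one[OF E(1) hol(1) E(2) bG bF dG dF this lG lF X_ge_1]
    show ?thesis by simp
  qed

  obtain R where R: "\<And>s. F s - G s = (L1 s - L2 s) * R s"
    "((\<lambda>s. R s * X s / X s ^ n) \<longlongrightarrow> of_nat n) (filtercomap Re at_bot)"
    using prod_diff_factor[OF assms(13) left1 left2 inv_X X_nz] unfolding F_def G_def assms(14) by blast
  \<comment> \<open>A nonzero limit keeps \<open>R\<close> from vanishing far to the left, so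
    \<open>F = G\<close> forces \<open>L1 = L2\<close> there.\<close>
  have "of_nat n \<noteq> (0::complex)" using assms(12) by simp
  with R(2) have "\<forall>\<^sub>F s in filtercomap Re at_bot. R s * X s / X s ^ n \<noteq> 0"
    by (rule tendsto_imp_eventually_ne)
  hence "\<forall>\<^sub>F s in filtercomap Re at_bot. L1 s - L2 s = 0"
  proof eventually_elim
    case (elim s)
    have "(L1 s - L2 s) * R s = 0" using R(1)[of s] FG[of s] by simp
    thus ?case using elim by simp
  qed
  then obtain x where x: "\<And>s. Re s \<le> x \<Longrightarrow> L1 s - L2 s = 0"
    by (auto simp: eventually_filtercomap_at_bot_linorder)
  have "L1 s - L2 s = 0" for s
  proof -
    \<comment> \<open>Replacing \<open>s\<close> by \<open>-s\<close> turns the left half plane of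
      equality into a right one.\<close>
    have "(\<lambda>s. L1 (-s) - L2 (-s)) holomorphic_on UNIV"
      using holomorphic_on_compose_gen[OF _ hol1, of uminus UNIV]
        holomorphic_on_compose_gen[OF _ hol2, of uminus UNIV]
      by (intro holomorphic_intros) (auto simp: o_def holomorphic_on_minus)
    from entire_constant_on_half_plane[OF this, of "-x" 0 "-s"] show ?thesis using x by simp
  qed
  thus ?thesis by (auto simp: fun_eq_iff)
qed

end
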